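(* For every integer $n\ge 0$ and every integer $k\ge 1$, one has, as polynomials in $x$ (i.e. for all $x\in\mathbb{C}_p$), \[ D_n^{(k)}(x)=\sum_{l=0}^{n}S_1(n,l)\,B_l^{(k)}(x). \]
   Context: Fix a prime $p$. $\mathbb{Z}_p$ is the ring of $p$-adic integers and $\mathbb{C}_p$ is the completion of an algebraic closure of $\mathbb{Q}_p$. For a uniformly differentiable function $f$ on $\mathbb{Z}_p$ (with values in $\mathbb{C}_p$), the $p$-adic invariant (Volkenborn) integral is $\int_{\mathbb{Z}_p}f(x)\,d\mu(x)=\lim_{N\to\infty}\frac{1}{p^N}\sum_{x=0}^{p^N-1}f(x)$. Write $(y)_n=y(y-1)\cdots(y-n+1)$ (with $(y)_0=1$). The signed Stirling numbers of the first kind $S_1(n,l)$ are defined by $(y)_n=\sum_{l=0}^n S_1(n,l)y^l$. The Daehee polynomials (of the first kind) of order $k$ are defined by the $k$-fold iterated integral \[ D_n^{(k)}(x)=\int_{\mathbb{Z}_p}\cdots\int_{\mathbb{Z}_p}(x_1+\cdots+x_k+x)_n\,d\mu(x_1)\cdots d\mu(x_k). \] The Bernoulli polynomials of order $\alpha\in\mathbb{N}$ are defined by $\left(\frac{t}{e^t-1}\right)^{\alpha}e^{xt}=\sum_{n\ge0}B_n^{(\alpha)}(x)\frac{t^n}{n!}$. *)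

theory Defs
  imports
    "HOL-Analysis.Analysis"
    "HOL-Computational_Algebra.Computational_Algebra"
begin

text \<open>
  The field of p-adic complex numbers is only determined up to isometric isomorphism, so it is
  represented by an arbitrary type carrying a complete ultrametric absolute value and subject to
  the predicate \<open>is_padic_complex\<close> below, which says that the type is a completion of an algebraic
  closure of a completion of the rationals with respect to the p-adic absolute value.
\<close>

class complete_ultrametric_field = field_char_0 + complete_space +
  fixes abs_val :: "'a \<Rightarrow> real"
  assumes dist_abs_val: "dist x y = abs_val (x - y)"
    and abs_val_mult: "abs_val (x * y) = abs_val x * abs_val y"
    and abs_val_ultrametric: "abs_val (x + y) \<le> max (abs_val x) (abs_val y)"

text \<open>In a complete field the closure of a subfield is its completion.\<close>

definition padic_rats :: "'c::complete_ultrametric_field set" where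
  "padic_rats = closure \<rat>"

definition padic_ints :: "'c::complete_ultrametric_field set" where
  "padic_ints = {x \<in> padic_rats. abs_val x \<le> 1}"

definition algebraic_elements :: "'c::field set \<Rightarrow> 'c set" where
  "algebraic_elements F = {x. \<exists>q. q \<noteq> 0 \<and> (\<forall>i. coeff q i \<in> F) \<and> poly q x = 0}"

definition algebraically_closed_set :: "'c::field set \<Rightarrow> bool" where
  "algebraically_closed_set F \<longleftrightarrow>
     (\<forall>q. degree q > 0 \<and> (\<forall>i. coeff q i \<in> F) \<longrightarrow> (\<exists>x\<in>F. poly q x = 0))"

definition is_padic_complex :: "nat \<Rightarrow> 'c::complete_ultrametric_field itself \<Rightarrow> bool" where
  "is_padic_complex p _ \<longleftrightarrow>
     (\<forall>m::int. m \<noteq> 0 \<longrightarrow> abs_val (of_int m :: 'c) = inverse (real p ^ multiplicity (int p) m)) \<and>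
     algebraically_closed_set (algebraic_elements (padic_rats :: 'c set)) \<and>
     closure (algebraic_elements (padic_rats :: 'c set)) = UNIV"

text \<open>
  Uniformity in the base point makes this the usual two-variable (strict) notion: by compactness
  of the p-adic integers it amounts to a continuous extension of the difference quotient to the
  diagonal, and pointwise differentiability alone would be too weak.
\<close>

definition uniformly_differentiable :: "('c::complete_ultrametric_field \<Rightarrow> 'c) \<Rightarrow> bool" where
  "uniformly_differentiable f \<longleftrightarrow>
     (\<exists>f'. \<forall>e>0. \<exists>d>0. \<forall>x\<in>padic_ints. \<forall>y\<in>padic_ints.
        x \<noteq> y \<and> abs_val (y - x) < d \<longrightarrow> abs_val ((f y - f x) / (y - x) - f' x) < e)"

definition volkenborn_integral ::
  "nat \<Rightarrow> ('c::complete_ultrametric_field \<Rightarrow> 'c) \<Rightarrow> 'c" where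
  "volkenborn_integral p f =
     (if uniformly_differentiable f
      then lim (\<lambda>N. 1 / of_nat (p ^ N) * (\<Sum>x<p ^ N. f (of_nat x)))
      else undefined)"

text \<open>
  The integrand takes the list \<open>[x\<^sub>1, \<dots>, x\<^sub>k]\<close>; \<open>x\<^sub>1\<close> is integrated first and
  \<open>x\<^sub>k\<close> last.
\<close>

primrec iterated_volkenborn ::
  "nat \<Rightarrow> nat \<Rightarrow> ('c::complete_ultrametric_field list \<Rightarrow> 'c) \<Rightarrow> 'c" where
  "iterated_volkenborn p 0 F = F []"
| "iterated_volkenborn p (Suc k) F =
     volkenborn_integral p (\<lambda>y. iterated_volkenborn p k (\<lambda>xs. F (xs @ [y])))"

definition falling_fact :: "'a::comm_ring_1 \<Rightarrow> nat \<Rightarrow> 'a" where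
  "falling_fact y n = (\<Prod>i<n. y - of_nat i)"

text \<open>
  The defining expansion of the falling factorial is read as an identity of polynomials in the
  indeterminate \<open>[:0, 1:]\<close>.
\<close>

definition stirling1_signed :: "nat \<Rightarrow> nat \<Rightarrow> int" where
  "stirling1_signed n l = coeff (falling_fact [:0, 1:] n) l"

definition daehee_poly ::
  "nat \<Rightarrow> nat \<Rightarrow> nat \<Rightarrow> 'c::complete_ultrametric_field \<Rightarrow> 'c" where
  "daehee_poly p k n x = iterated_volkenborn p k (\<lambda>xs. falling_fact (sum_list xs + x) n)"

text \<open>
  Division of formal power series cancels the common factor \<open>t\<close> in \<open>t / (e\<^sup>t - 1)\<close>.
\<close>

definition bernoulli_poly_order :: "nat \<Rightarrow> nat \<Rightarrow> 'a::field_char_0 \<Rightarrow> 'a" where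
  "bernoulli_poly_order k n x =
     fact n * fps_nth ((fps_X / (fps_exp 1 - 1)) ^ k * fps_exp x) n"

end

theory Submission
  imports Defs
begin

text \<open>
  With \<open>b = t / (e\<^sup>t - 1)\<close>, the geometric series gives
  \<open>\<Sum>x<M. e\<^bsup>xt\<^esup> = b \<sqdot> (e\<^bsup>Mt\<^esup> - 1) / t\<close>, so the mean of \<open>x\<^sup>m\<close> over \<open>x < M\<close> is a
  polynomial in \<open>M\<close> with constant term the Bernoulli number \<open>B\<^sub>m\<close>.  Since \<open>p\<^sup>N\<close> tends to zero
  \<open>p\<close>-adically, the Volkenborn integral of \<open>x\<^sup>m\<close> is \<open>B\<^sub>m\<close>.  Integrating \<open>B\<^sub>l\<^bsup>(k)\<^esup>(x + y)\<close> over \<open>y\<close>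
  therefore multiplies the generating function by another factor \<open>b\<close>, which raises the order by
  one; the theorem is the image of this under the expansion of the falling factorial.
\<close>

section \<open>The ultrametric absolute value\<close>

lemma abs_val_eq_dist: "abs_val x = dist x (0::'c::complete_ultrametric_field)"
  by (simp add: dist_abs_val)

lemma abs_val_nonneg: "abs_val (x::'c::complete_ultrametric_field) \<ge> 0"
  by (simp add: abs_val_eq_dist)

lemma abs_val_add_le: "abs_val (x + y) \<le> abs_val x + abs_val (y::'c::complete_ultrametric_field)"
  using abs_val_ultrametric[of x y] abs_val_nonneg[of x] abs_val_nonneg[of y] by linarith

lemma abs_val_poly_bounded:
  fixes q :: "'c::complete_ultrametric_field poly"
  shows "\<exists>C\<ge>0. \<forall>x. abs_val x \<le> 1 \<longrightarrow> abs_val (poly q x) \<le> C"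
proof (induction q)
  case 0
  show ?case by (auto simp: abs_val_eq_dist)
next
  case (pCons a q)
  then obtain C where C: "C \<ge> 0" "\<And>x. abs_val x \<le> 1 \<Longrightarrow> abs_val (poly q x) \<le> C" by blast
  have "abs_val (poly (pCons a q) x) \<le> abs_val a + C" if "abs_val x \<le> 1" for x
  proof -
    have "abs_val (x * poly q x) \<le> 1 * C"
      unfolding abs_val_mult using that C abs_val_nonneg by (intro mult_mono) auto
    then show ?thesis using abs_val_add_le[of a "x * poly q x"] by simp
  qed
  then show ?case using C(1) abs_val_nonneg[of a] by (intro exI[of _ "abs_val a + C"]) auto
qed

section \<open>Polynomials and the Volkenborn integral\<close>

text \<open>First-order Taylor formula with a remainder bounded uniformly on the unit ball, which
  contains \<open>padic_ints\<close>. In the Horner form \<open>a + X * q\<close> the new remainder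
  is \<open>q'(x) + y * h\<close>, whence the bound \<open>D + C\<close>.\<close>

lemma poly_second_order_expansion:
  fixes q :: "'c::complete_ultrametric_field poly"
  shows "\<exists>C\<ge>0. \<forall>x y. abs_val x \<le> 1 \<and> abs_val y \<le> 1 \<longrightarrow>
           (\<exists>h. abs_val h \<le> C \<and>
              poly q y - poly q x = (y - x) * poly (pderiv q) x + (y - x) ^ 2 * h)"
proof (induction q)
  case 0
  show ?case by (intro exI[of _ 0]) (auto simp: abs_val_eq_dist)
next
  case (pCons a q)
  then obtain C where C: "C \<ge> 0"
    and exp: "\<And>x y. abs_val x \<le> 1 \<Longrightarrow> abs_val y \<le> 1 \<Longrightarrow> \<exists>h. abs_val h \<le> C \<and>
        poly q y - poly q x = (y - x) * poly (pderiv q) x + (y - x) ^ 2 * h"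
    by blast
  obtain D where D: "D \<ge> 0" "\<And>x. abs_val x \<le> 1 \<Longrightarrow> abs_val (poly (pderiv q) x) \<le> D"
    using abs_val_poly_bounded by blast
  show ?case
  proof (intro exI[of _ "D + C"] conjI allI impI)
    show "0 \<le> D + C" using C D by simp
  next
    fix x y :: 'c
    assume xy: "abs_val x \<le> 1 \<and> abs_val y \<le> 1"
    then obtain h where h: "abs_val h \<le> C"
      "poly q y - poly q x = (y - x) * poly (pderiv q) x + (y - x) ^ 2 * h"
      using exp by blast
    have "abs_val (y * h) \<le> 1 * C"
      unfolding abs_val_mult using xy h(1) C abs_val_nonneg by (intro mult_mono) auto
    then have bound: "abs_val (poly (pderiv q) x + y * h) \<le> D + C"
      using abs_val_add_le[of "poly (pderiv q) x" "y * h"] D(2)[of x] xy by simp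
    have "poly (pCons a q) y - poly (pCons a q) x
        = (y - x) * poly q x + y * (poly q y - poly q x)"
      by (simp add: algebra_simps)
    also have "\<dots> = (y - x) * poly (pderiv (pCons a q)) x
        + (y - x) ^ 2 * (poly (pderiv q) x + y * h)"
      unfolding h(2) by (simp add: pderiv_pCons algebra_simps power2_eq_square)
    finally show "\<exists>h. abs_val h \<le> D + C \<and> poly (pCons a q) y - poly (pCons a q) x
        = (y - x) * poly (pderiv (pCons a q)) x + (y - x) ^ 2 * h"
      using bound by blast
  qed
qed

text \<open>\<open>volkenborn_integral\<close> unfolds to the limit of means only for such
  functions.\<close>

lemma uniformly_differentiable_poly:
  "uniformly_differentiable (poly (q::'c::complete_ultrametric_field poly))"
proof -
  obtain C where C: "C \<ge> 0"
    and exp: "\<And>x y. abs_val x \<le> 1 \<Longrightarrow> abs_val y \<le> 1 \<Longrightarrow> \<exists>h. abs_val h \<le> C \<and>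
        poly q y - poly q x = (y - x) * poly (pderiv q) x + (y - x) ^ 2 * h"
    using poly_second_order_expansion[of q] by blast
  \<comment> \<open>\<open>C\<close> may be \<open>0\<close>; the \<open>+ 1\<close> keeps the
    radius \<open>e / (C + 1)\<close> positive.\<close>
  have "abs_val ((poly q y - poly q x) / (y - x) - poly (pderiv q) x) < e"
    if e: "e > 0" and xy: "abs_val x \<le> 1" "abs_val y \<le> 1" "x \<noteq> y"
      and d: "abs_val (y - x) < e / (C + 1)" for x y e
  proof -
    obtain h where h: "abs_val h \<le> C"
      "poly q y - poly q x = (y - x) * poly (pderiv q) x + (y - x) ^ 2 * h"
      using exp xy by blast
    have "(poly q y - poly q x) / (y - x) - poly (pderiv q) x = (y - x) * h"
      unfolding h(2) using xy(3) by (simp add: field_simps power2_eq_square)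
    moreover have "abs_val (y - x) * abs_val h \<le> abs_val (y - x) * (C + 1)"
      using h(1) abs_val_nonneg by (intro mult_left_mono) auto
    moreover have "abs_val (y - x) * (C + 1) < e"
      using d C by (simp add: field_simps)
    ultimately show ?thesis by (simp add: abs_val_mult)
  qed
  then have "e / (C + 1) > 0 \<and> (\<forall>x\<in>padic_ints. \<forall>y\<in>padic_ints.
      x \<noteq> y \<and> abs_val (y - x) < e / (C + 1) \<longrightarrow>
      abs_val ((poly q y - poly q x) / (y - x) - poly (pderiv q) x) < e)" if "e > 0" for e
    using that C by (simp add: padic_ints_def)
  then show ?thesis
    unfolding uniformly_differentiable_def by meson
qed

lemma poly_tendsto_at_zero:
  fixes q :: "'c::complete_ultrametric_field poly"
  assumes "(\<lambda>N. abs_val (X N)) \<longlonglongrightarrow> 0"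
  shows "(\<lambda>N. poly q (X N)) \<longlonglongrightarrow> poly q 0"
proof (cases q)
  case (pCons a r)
  obtain C where C: "C \<ge> 0" "\<And>x. abs_val x \<le> 1 \<Longrightarrow> abs_val (poly r x) \<le> C"
    using abs_val_poly_bounded by blast
  \<comment> \<open>The bound on the cofactor \<open>r\<close> in \<open>q = a + X * r\<close> holds
    on the unit ball, which \<open>X N\<close> eventually enters.\<close>
  have "eventually (\<lambda>N. abs_val (X N) < 1) sequentially"
    using assms by (rule order_tendstoD) simp
  then have "eventually (\<lambda>N. dist (poly q (X N)) (poly q 0) \<le> abs_val (X N) * C) sequentially"
  proof eventually_elim
    case (elim N)
    then show ?case
      using C(2)[of "X N"] abs_val_nonneg
      by (auto simp: dist_abs_val pCons abs_val_mult intro!: mult_left_mono)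
  qed
  moreover have "(\<lambda>N. abs_val (X N) * C) \<longlonglongrightarrow> 0"
    using tendsto_mult_left_zero[OF assms] by simp
  ultimately have "(\<lambda>N. dist (poly q (X N)) (poly q 0)) \<longlonglongrightarrow> 0"
    by (rule tendsto_sandwich[OF always_eventually _ tendsto_const, rotated]) simp
  then show ?thesis by (rule iffD2[OF tendsto_dist_iff])
qed

lemma abs_val_prime_power_tendsto:
  assumes "prime p" "is_padic_complex p TYPE('c::complete_ultrametric_field)"
  shows "(\<lambda>N. abs_val (of_nat (p ^ N) :: 'c)) \<longlonglongrightarrow> 0"
proof -
  have p: "p > 1" using assms(1) by (rule prime_gt_1_nat)
  have "abs_val (of_int m :: 'c) = inverse (real p ^ multiplicity (int p) m)" if "m \<noteq> 0" for m
    using assms(2) that unfolding is_padic_complex_def by blast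
  from this[of "int (p ^ N)" for N]
  have "abs_val (of_nat (p ^ N) :: 'c) = inverse (real p ^ N)" for N
    using p by (simp add: multiplicity_same_power)
  moreover have "(\<lambda>N. inverse (real p ^ N)) \<longlonglongrightarrow> 0"
    using p by (intro LIMSEQ_inverse_realpow_zero) simp
  ultimately show ?thesis by simp
qed

section \<open>Bernoulli numbers as constant terms of means of powers\<close>

abbreviation bernoulli_fps :: "'a::field_char_0 fps" where
  "bernoulli_fps \<equiv> fps_X / (fps_exp 1 - 1)"

lemma fps_exp_minus_one_nonzero: "fps_exp 1 - 1 \<noteq> (0::'a::field_char_0 fps)"
proof
  assume "fps_exp 1 - 1 = (0::'a fps)"
  then have "fps_nth (fps_exp 1 - 1 :: 'a fps) 1 = 0" by simp
  then show False by simp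
qed

text \<open>The division is exact because e^t - 1 has order at most one in t.\<close>

lemma bernoulli_fps_mult: "bernoulli_fps * (fps_exp 1 - 1) = (fps_X::'a::field_char_0 fps)"
proof -
  have "subdegree (fps_exp 1 - 1 :: 'a fps) \<le> 1"
    by (rule subdegree_leI) simp
  then have "(fps_exp 1 - 1 :: 'a fps) dvd fps_X"
    using fps_exp_minus_one_nonzero by (subst fps_dvd_iff) auto
  then show ?thesis by simp
qed

lemma sum_powers_bernoulli:
  "(\<Sum>x<M. of_nat x ^ m / fact m :: 'a::field_char_0) =
     (\<Sum>j\<le>m. fps_nth bernoulli_fps j * of_nat M ^ Suc (m - j) / fact (Suc (m - j)))"
proof -
  \<comment> \<open>\<open>G\<close> is (e^(Mt) - 1) / t, hence the shift to
    \<open>Suc i\<close>.\<close>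
  define G :: "'a fps" where "G = Abs_fps (\<lambda>i. of_nat M ^ Suc i / fact (Suc i))"
  define S :: "'a fps" where "S = (\<Sum>x<M. fps_exp (of_nat x))"
  \<comment> \<open>The geometric sum telescopes.\<close>
  have "S * (fps_exp 1 - 1) = fps_exp (of_nat M) - 1"
    unfolding S_def
    by (induction M) (simp_all add: algebra_simps fps_exp_add_mult)
  also have "\<dots> = fps_X * G"
    by (rule fps_ext) (auto simp: G_def gr0_conv_Suc simp del: fact_Suc split: nat.splits)
  also have "\<dots> = bernoulli_fps * G * (fps_exp 1 - 1)"
    by (subst bernoulli_fps_mult[symmetric]) (simp only: mult_ac)
  finally have "S = bernoulli_fps * G"
    using fps_exp_minus_one_nonzero by simp
  then have "fps_nth S m = fps_nth (bernoulli_fps * G) m" by simp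
  then show ?thesis
    by (simp add: S_def G_def fps_sum_nth fps_mult_nth atMost_atLeast0 del: fact_Suc)
qed

text \<open>Every term of the power sum carries a factor \<open>M\<close>, so division by
  \<open>M\<close> leaves a polynomial in \<open>M\<close>; its value at 0 is the Bernoulli number
  B_m.\<close>

lemma mean_power_polynomial:
  "\<exists>R. poly R 0 = fact m * fps_nth bernoulli_fps m \<and>
     (\<forall>M>0. 1 / of_nat M * (\<Sum>x<M. of_nat x ^ m :: 'a::field_char_0) = poly R (of_nat M))"
proof (intro exI conjI allI impI)
  let ?R = "\<Sum>j\<le>m. monom (fact m * fps_nth bernoulli_fps j / fact (Suc (m - j)) :: 'a) (m - j)"
  \<comment> \<open>At 0 only the exponent \<open>m - j = 0\<close> survives.\<close>
  have "poly ?R 0 = (\<Sum>j\<le>m. if j = m then fact m * fps_nth bernoulli_fps m else 0)"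
    unfolding poly_sum poly_monom by (rule sum.cong) (auto simp: power_0_left)
  then show "poly ?R 0 = fact m * fps_nth bernoulli_fps m" by simp
  fix M :: nat
  assume M: "M > 0"
  have "(\<Sum>x<M. of_nat x ^ m :: 'a) = fact m * (\<Sum>x<M. of_nat x ^ m / fact m)"
    by (simp add: sum_distrib_left)
  then show "1 / of_nat M * (\<Sum>x<M. of_nat x ^ m :: 'a) = poly ?R (of_nat M)"
    using M unfolding sum_powers_bernoulli
    by (simp add: sum_distrib_left poly_sum poly_monom mult_ac del: fact_Suc)
qed

text \<open>Exponents may repeat over the index set, so that a double sum can be integrated without
  collecting equal powers.\<close>

lemma volkenborn_integral_sum_powers:
  fixes c :: "'i \<Rightarrow> 'c::complete_ultrametric_field"
  assumes "prime p" "is_padic_complex p TYPE('c)"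
  shows "volkenborn_integral p (\<lambda>y. \<Sum>a\<in>A. c a * y ^ e a) =
           (\<Sum>a\<in>A. c a * (fact (e a) * fps_nth bernoulli_fps (e a)))"
proof -
  let ?f = "\<lambda>y. \<Sum>a\<in>A. c a * y ^ e a"
  let ?mean = "\<lambda>M f. 1 / of_nat M * (\<Sum>x<M. f (of_nat x)) :: 'c"
  have "?f = poly (\<Sum>a\<in>A. monom (c a) (e a))"
    by (simp add: fun_eq_iff poly_sum poly_monom)
  then have diff: "uniformly_differentiable ?f"
    by (simp only: uniformly_differentiable_poly)
  obtain R :: "nat \<Rightarrow> 'c poly" where R0: "\<And>m. poly (R m) 0 = fact m * fps_nth bernoulli_fps m"
    and R: "\<And>m M. M > 0 \<Longrightarrow> ?mean M (\<lambda>x. x ^ m) = poly (R m) (of_nat M)"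
    using mean_power_polynomial[where 'a = 'c] by metis
  define Q where "Q = (\<Sum>a\<in>A. smult (c a) (R (e a)))"
  have mean: "?mean M ?f = poly Q (of_nat M)" if "M > 0" for M
  proof -
    have "?mean M ?f = (\<Sum>a\<in>A. c a * ?mean M (\<lambda>x. x ^ e a))"
      by (subst sum.swap) (simp add: sum_distrib_left mult_ac)
    then show ?thesis using that by (simp only: R Q_def poly_sum poly_smult)
  qed
  \<comment> \<open>The mean is given by \<open>Q\<close> only for positive
    \<open>M\<close>.\<close>
  have "p ^ N > 0" for N
    using prime_gt_0_nat[OF assms(1)] by (rule zero_less_power)
  note mean_prime_power = mean[OF this]
  have "(\<lambda>N. poly Q (of_nat (p ^ N))) \<longlonglongrightarrow> poly Q 0"
    by (intro poly_tendsto_at_zero abs_val_prime_power_tendsto assms)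
  then have "lim (\<lambda>N. ?mean (p ^ N) ?f) = poly Q 0"
    unfolding mean_prime_power by (rule limI)
  then show ?thesis
    using diff by (simp add: volkenborn_integral_def Q_def poly_sum R0)
qed

section \<open>Bernoulli polynomials of higher order\<close>

text \<open>The factor e^(yt) is split off so that the coefficients of the powers of
  \<open>y\<close> do not involve \<open>y\<close>.\<close>

lemma bernoulli_poly_order_add:
  "bernoulli_poly_order k l (x + y) =
     (\<Sum>i\<le>l. fact l * fps_nth (bernoulli_fps ^ k * fps_exp x) (l - i) / fact i * y ^ i)"
proof -
  have "bernoulli_fps ^ k * fps_exp (x + y) = fps_exp y * (bernoulli_fps ^ k * fps_exp x)"
    by (simp add: fps_exp_add_mult mult_ac)
  then have "bernoulli_poly_order k l (x + y) =
      fact l * fps_nth (fps_exp y * (bernoulli_fps ^ k * fps_exp x)) l"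
    by (simp only: bernoulli_poly_order_def)
  then show ?thesis
    unfolding fps_mult_nth[of "fps_exp y"] sum_distrib_left atMost_atLeast0
    by (simp add: mult_ac)
qed

text \<open>Splitting off one factor b gives the addition formula with \<open>y ^ i\<close> replaced
  by B_i, which is exactly the effect of integrating over \<open>y\<close>.\<close>

lemma bernoulli_poly_order_Suc:
  "bernoulli_poly_order (Suc k) l x =
     (\<Sum>i\<le>l. fact l * fps_nth (bernoulli_fps ^ k * fps_exp x) (l - i) / fact i
        * (fact i * fps_nth bernoulli_fps i))"
  unfolding bernoulli_poly_order_def power_Suc mult.assoc[of bernoulli_fps]
    fps_mult_nth[of bernoulli_fps] sum_distrib_left atMost_atLeast0
  by (simp add: mult_ac)

text \<open>The outermost variable \<open>y\<close> is the last list entry, so the inner integral is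
  the induction hypothesis at \<open>x + y\<close>; this is why \<open>x\<close> is kept
  arbitrary.\<close>

lemma iterated_volkenborn_sum_powers:
  fixes c :: "nat \<Rightarrow> 'c::complete_ultrametric_field"
  assumes "prime p" "is_padic_complex p TYPE('c)"
  shows "iterated_volkenborn p k (\<lambda>xs. \<Sum>l\<le>n. c l * (sum_list xs + x) ^ l) =
           (\<Sum>l\<le>n. c l * bernoulli_poly_order k l x)"
proof (induction k arbitrary: x)
  case 0
  show ?case by (simp add: bernoulli_poly_order_def)
next
  case (Suc k)
  \<comment> \<open>\<open>w (l, i)\<close> is the coefficient of \<open>y ^ i\<close> in the term
    of index \<open>l\<close>; indexing by pairs makes the double sum a single one.\<close>
  define w where
    "w = (\<lambda>(l, i). c l * (fact l * fps_nth (bernoulli_fps ^ k * fps_exp x) (l - i) / fact i))"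
  let ?A = "SIGMA l:{..n}. {..l}"
  have inner: "iterated_volkenborn p k (\<lambda>xs. \<Sum>l\<le>n. c l * (sum_list (xs @ [y]) + x) ^ l) =
      (\<Sum>a\<in>?A. w a * y ^ snd a)" for y
  proof -
    have "iterated_volkenborn p k (\<lambda>xs. \<Sum>l\<le>n. c l * (sum_list (xs @ [y]) + x) ^ l) =
        (\<Sum>l\<le>n. c l * bernoulli_poly_order k l (x + y))"
      using Suc.IH[of "x + y"] by (simp add: add_ac)
    also have "\<dots> = (\<Sum>l\<le>n. \<Sum>i\<le>l. w (l, i) * y ^ snd (l, i))"
      by (simp add: bernoulli_poly_order_add sum_distrib_left w_def mult_ac)
    finally show ?thesis by (simp add: sum.Sigma case_prod_beta)
  qed
  have "iterated_volkenborn p (Suc k) (\<lambda>xs. \<Sum>l\<le>n. c l * (sum_list xs + x) ^ l) =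
      (\<Sum>a\<in>?A. w a * (fact (snd a) * fps_nth bernoulli_fps (snd a)))"
    unfolding iterated_volkenborn.simps inner
    using assms by (rule volkenborn_integral_sum_powers)
  also have "\<dots> = (\<Sum>l\<le>n. \<Sum>i\<le>l. w (l, i) * (fact i * fps_nth bernoulli_fps i))"
    by (simp add: sum.Sigma case_prod_beta)
  also have "\<dots> = (\<Sum>l\<le>n. c l * bernoulli_poly_order (Suc k) l x)"
    by (simp only: bernoulli_poly_order_Suc sum_distrib_left w_def prod.case mult.assoc)
  finally show ?case .
qed

section \<open>Expansion of the falling factorial\<close>

lemma falling_fact_X_Suc:
  "falling_fact [:0, 1:] (Suc n) = falling_fact [:0, 1:] n * [:- of_nat n, 1::'a::comm_ring_1:]"
  by (simp add: falling_fact_def of_nat_poly)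

text \<open>Stirling numbers are defined over the integers; the recursion in \<open>n\<close> has
  integer coefficients and so carries them to any commutative ring.\<close>

lemma coeff_falling_fact:
  "coeff (falling_fact [:0, 1::'a::comm_ring_1:] n) l = of_int (stirling1_signed n l)"
proof (induction n arbitrary: l)
  case 0
  show ?case by (simp add: stirling1_signed_def falling_fact_def)
next
  case (Suc n)
  then show ?case
    by (cases l) (simp_all add: falling_fact_X_Suc stirling1_signed_def coeff_pCons)
qed

lemma falling_fact_eq_sum_stirling:
  fixes y :: "'a::idom"
  shows "falling_fact y n = (\<Sum>l\<le>n. of_int (stirling1_signed n l) * y ^ l)"
proof -
  \<comment> \<open>The degree bound lets the monomial expansion stop at \<open>n\<close>.\<close>
  have "degree (falling_fact [:0, 1::'a:] n) \<le> n"
  proof (induction n)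
    case (Suc n)
    then show ?case
      using degree_mult_le[of "falling_fact [:0, 1::'a:] n" "[:- of_nat n, 1:]"]
      by (simp add: falling_fact_X_Suc)
  qed (simp add: falling_fact_def)
  then have "poly (falling_fact [:0, 1:] n) y =
      (\<Sum>l\<le>n. coeff (falling_fact [:0, 1:] n) l * y ^ l)"
    using poly_as_sum_of_monoms'[of "falling_fact [:0, 1:] n" n]
    by (metis (no_types, lifting) poly_sum poly_monom sum.cong)
  moreover have "poly (falling_fact [:0, 1:] n) y = falling_fact y n"
    by (simp add: falling_fact_def poly_prod)
  ultimately show ?thesis by (simp add: coeff_falling_fact)
qed

theorem theorem5:
  fixes p k n :: nat and x :: "'c::complete_ultrametric_field"
  assumes "prime p"
    and "is_padic_complex p TYPE('c)"
    and "k \<ge> 1"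
  shows "daehee_poly p k n x =
           (\<Sum>l=0..n. of_int (stirling1_signed n l) * bernoulli_poly_order k l x)"
  unfolding daehee_poly_def falling_fact_eq_sum_stirling atLeast0AtMost
  using assms(1,2) by (rule iterated_volkenborn_sum_powers)

end
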